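(* Let $\mathbf{P}\in\mathbb{R}^{d\times d}$ be positive definite and let $f$ and $g$ be functions on $\mathbb{R}^d$, with $f$ measurable and positive almost everywhere and $g\in H^1_{\mathrm{loc}}(\mathbb{R}^d)$, such that $\mathcal{I}_2^{\mathbf{P}}(f,g|f_\infty)=I_2^{\mathbf{P}}(g|f_\infty)$ and $\mathcal{I}_1^{\mathbf{P}}(f,g|f_\infty)$ are finite. Then for any $1<p<2$ $$\mathcal{I}_p^{\mathbf{P}}(f,g|f_\infty)\le\frac{1}{(p-1)^{p-1}(2-p)^{2-p}}\;\mathcal{I}_1^{\mathbf{P}}(f,g|f_\infty)^{2-p}\;I_2^{\mathbf{P}}(g|f_\infty)^{p-1}.$$
   Context: $f_\infty(x)=(2\pi)^{-d/2}e^{-|x|^2/2}$ is the standard Gaussian. For $1\le p\le2$ the generalised $p$-Fisher information is $$\mathcal{I}_p^{\mathbf{P}}(f,g|f_\infty)=\int_{\mathbb{R}^d}\Big(\frac{f(x)}{f_\infty(x)}\Big)^{p-2}\nabla\Big(\frac{g(x)}{f_\infty(x)}\Big)^T\mathbf{P}\,\nabla\Big(\frac{g(x)}{f_\infty(x)}\Big)f_\infty(x)\,dx,$$ defined for $f$ positive and $g\in H^1_{\mathrm{loc}}(\mathbb{R}^d)$ (it corresponds to $\psi_p''(y)=y^{p-2}$). For $p=2$ it does not depend on $f$ and is denoted $I_2^{\mathbf{P}}(g|f_\infty)$. *)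

theory Defs
  imports "HOL-Analysis.Analysis"
begin

definition partial_deriv :: "'n \<Rightarrow> (real ^ 'n \<Rightarrow> real) \<Rightarrow> real ^ 'n \<Rightarrow> real" where
  "partial_deriv i \<phi> x = frechet_derivative \<phi> (at x) (axis i 1)"

primrec C_k :: "nat \<Rightarrow> (real ^ 'n \<Rightarrow> real) \<Rightarrow> bool" where
  "C_k 0 \<phi> \<longleftrightarrow> continuous_on UNIV \<phi>"
| "C_k (Suc k) \<phi> \<longleftrightarrow> (\<forall>x. \<phi> differentiable (at x)) \<and> (\<forall>i. C_k k (partial_deriv i \<phi>))"

text \<open>The space \<open>C\<^sub>c\<^sup>\<infinity>\<close> of smooth functions with compact support.\<close>

definition test_function :: "(real ^ 'n \<Rightarrow> real) \<Rightarrow> bool" where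
  "test_function \<phi> \<longleftrightarrow> (\<forall>k. C_k k \<phi>) \<and> compact (closure {x. \<phi> x \<noteq> 0})"

definition locally_integrable :: "(real ^ 'n \<Rightarrow> 'b :: euclidean_space) \<Rightarrow> bool" where
  "locally_integrable h \<longleftrightarrow> (\<forall>K. compact K \<longrightarrow> set_integrable lebesgue K h)"

definition L2_loc :: "(real ^ 'n \<Rightarrow> 'b :: euclidean_space) \<Rightarrow> bool" where
  "L2_loc h \<longleftrightarrow> h \<in> borel_measurable lebesgue \<and>
     (\<forall>K. compact K \<longrightarrow> set_integrable lebesgue K (\<lambda>x. (norm (h x))\<^sup>2))"

definition has_weak_gradient :: "(real ^ 'n \<Rightarrow> real) \<Rightarrow> (real ^ 'n \<Rightarrow> real ^ 'n) \<Rightarrow> bool" where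
  "has_weak_gradient h G \<longleftrightarrow> locally_integrable h \<and> locally_integrable G \<and>
     (\<forall>\<phi> i. test_function \<phi> \<longrightarrow>
        (LINT x|lebesgue. h x * partial_deriv i \<phi> x) = - (LINT x|lebesgue. (G x $ i) * \<phi> x))"

text \<open>A weak gradient is determined only up to a null set, so \<open>weak_gradient\<close> picks a representative;
  the integrals below do not depend on it.\<close>

definition weak_gradient :: "(real ^ 'n \<Rightarrow> real) \<Rightarrow> real ^ 'n \<Rightarrow> real ^ 'n" where
  "weak_gradient h = (SOME G. has_weak_gradient h G)"

definition H1_loc :: "(real ^ 'n \<Rightarrow> real) \<Rightarrow> bool" where
  "H1_loc h \<longleftrightarrow> L2_loc h \<and> (\<exists>G. has_weak_gradient h G \<and> L2_loc G)"

text \<open>Symmetry is not part of the definition.\<close>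

definition positive_definite :: "real ^ 'n ^ 'n \<Rightarrow> bool" where
  "positive_definite P \<longleftrightarrow> (\<forall>x. x \<noteq> 0 \<longrightarrow> 0 < x \<bullet> (P *v x))"

definition f_inf :: "real ^ 'n \<Rightarrow> real" where
  "f_inf x = (2 * pi) powr (- (real CARD('n) / 2)) * exp (- (norm x)\<^sup>2 / 2)"

text \<open>For positive definite \<open>P\<close> the integrand is nonnegative, so the integral is taken in
  \<open>[0, \<infinity>]\<close> and \<^const>\<open>ennreal\<close> truncates nothing. If \<open>f > 0\<close> almost everywhere, the values of
  \<open>powr\<close> at nonpositive arguments matter only on a null set.\<close>

definition fisher_information ::
    "real \<Rightarrow> real ^ 'n ^ 'n \<Rightarrow> (real ^ 'n \<Rightarrow> real) \<Rightarrow> (real ^ 'n \<Rightarrow> real) \<Rightarrow> ennreal" where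
  "fisher_information p P f g =
     (\<integral>\<^sup>+ x. ennreal ((f x / f_inf x) powr (p - 2) *
        (weak_gradient (\<lambda>y. g y / f_inf y) x \<bullet> (P *v weak_gradient (\<lambda>y. g y / f_inf y) x)) *
        f_inf x) \<partial>lebesgue)"

definition fisher_information_2 :: "real ^ 'n ^ 'n \<Rightarrow> (real ^ 'n \<Rightarrow> real) \<Rightarrow> ennreal" where
  "fisher_information_2 P g =
     (\<integral>\<^sup>+ x. ennreal (
        (weak_gradient (\<lambda>y. g y / f_inf y) x \<bullet> (P *v weak_gradient (\<lambda>y. g y / f_inf y) x)) *
        f_inf x) \<partial>lebesgue)"

lemma f_inf_pos: "0 < f_inf x"
  by (simp add: f_inf_def)

lemma fisher_information_2_eq:
  assumes "AE x in lebesgue. 0 < f x"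
  shows "fisher_information 2 P f g = fisher_information_2 P g"
  unfolding fisher_information_def fisher_information_2_def
proof (rule nn_integral_cong_AE, use assms in eventually_elim)
  case (elim x)
  then have "f x / f_inf x \<noteq> 0"
    using f_inf_pos[of x] by simp
  then show ?case by simp
qed

end

theory Submission
  imports Defs
begin

text \<open>With \<open>\<theta> = 2 - p\<close> and \<open>a = f_inf / f\<close>, all three integrals have the form \<open>\<integral> a\<^sup>s w\<close>, where
  \<open>s \<in> {\<theta>, 1, 0}\<close> and \<open>w\<close> does not depend on \<open>s\<close>. Integrating Young's inequality
  \<open>a\<^sup>\<theta> \<le> \<theta> \<lambda>\<^sup>1\<^sup>-\<^sup>\<theta> a + (1 - \<theta>) \<lambda>\<^sup>-\<^sup>\<theta>\<close> against \<open>w\<close> and optimising over \<open>\<lambda>\<close> gives the bound with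
  constant \<open>1\<close>, and the constant of the theorem is at least \<open>1\<close>.

  The integral \<open>\<integral>\<^sup>+\<close> of a non-measurable function is a lower integral. Because only the factor
  \<open>a\<^sup>s\<close> changes and \<open>a\<close> is measurable, the linear bound still integrates for a non-measurable \<open>w\<close>: divide
  a simple function below \<open>a\<^sup>\<theta> w\<close> by \<open>a\<^sup>\<theta>\<close> to get a measurable function below \<open>w\<close>.\<close>

text \<open>Young's inequality for \<open>c * a\<close> and 1 with weights \<open>\<theta>\<close>
  and \<open>1 - \<theta>\<close>, divided by \<open>c powr \<theta>\<close>.\<close>

lemma Young_powr_scaled:
  fixes a c \<theta> :: real
  assumes "0 < a" "0 < c" "0 \<le> \<theta>" "\<theta> \<le> 1"
  shows "a powr \<theta> \<le> \<theta> * c powr (1 - \<theta>) * a + (1 - \<theta>) * c powr (- \<theta>)"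
proof -
  have "(c * a) powr \<theta> \<le> \<theta> * (c * a) + (1 - \<theta>)"
    using Youngs_inequality_0[of \<theta> "1 - \<theta>" "c * a" 1] assms by simp
  then have "c powr (- \<theta>) * (c powr \<theta> * a powr \<theta>) \<le> c powr (- \<theta>) * (\<theta> * (c * a) + (1 - \<theta>))"
    using assms by (intro mult_left_mono) (auto simp: powr_mult)
  moreover have "c powr (1 - \<theta>) = c * c powr (- \<theta>)"
    using powr_add[of c 1 "- \<theta>"] assms by simp
  moreover have "c powr (- \<theta>) * c powr \<theta> = 1"
    using powr_add[of c "- \<theta>" \<theta>] assms by simp
  ultimately show ?thesis
    by (simp add: algebra_simps)
qed

lemma nn_integral_weight_le_linear:
  fixes a b :: "'a \<Rightarrow> real" and w :: "'a \<Rightarrow> ennreal" and c d :: ennreal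
  assumes [measurable]: "a \<in> borel_measurable M" "b \<in> borel_measurable M"
    and pos: "\<And>x. 0 < b x"
    and le: "\<And>x. ennreal (b x) \<le> c * ennreal (a x) + d"
  shows "(\<integral>\<^sup>+x. ennreal (b x) * w x \<partial>M) \<le> c * (\<integral>\<^sup>+x. ennreal (a x) * w x \<partial>M) + d * (\<integral>\<^sup>+x. w x \<partial>M)"
  unfolding nn_integral_def[of M "\<lambda>x. ennreal (b x) * w x"]
proof (rule SUP_least)
  fix u assume "u \<in> {g. simple_function M g \<and> g \<le> (\<lambda>x. ennreal (b x) * w x)}"
  then have simple: "simple_function M u" and u_le: "\<And>x. u x \<le> ennreal (b x) * w x"
    by (auto simp: le_fun_def)
  have [measurable]: "u \<in> borel_measurable M"
    using simple by (rule borel_measurable_simple_function)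
  define v where "v x = u x * ennreal (1 / b x)" for x
  have [measurable]: "v \<in> borel_measurable M"
    unfolding v_def by measurable
  have cancel: "ennreal (b x) * ennreal (1 / b x) = 1" for x
    using pos[of x] by (simp flip: ennreal_mult)
  have u_eq: "u x = ennreal (b x) * v x" for x
    unfolding v_def using cancel[of x] by (metis mult.left_commute mult.right_neutral)
  have v_le: "v x \<le> w x" for x
  proof -
    have "v x \<le> ennreal (b x) * w x * ennreal (1 / b x)"
      unfolding v_def by (intro mult_right_mono u_le) simp
    also have "\<dots> = w x"
      using cancel[of x] by (metis mult.assoc mult.commute mult.left_neutral)
    finally show ?thesis .
  qed
  have "integral\<^sup>S M u = (\<integral>\<^sup>+x. u x \<partial>M)"
    using simple by (simp add: nn_integral_eq_simple_integral)
  also have "\<dots> \<le> (\<integral>\<^sup>+x. c * (ennreal (a x) * v x) + d * v x \<partial>M)"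
  proof (rule nn_integral_mono)
    fix x
    have "u x \<le> (c * ennreal (a x) + d) * v x"
      unfolding u_eq by (intro mult_right_mono le) simp
    then show "u x \<le> c * (ennreal (a x) * v x) + d * v x"
      by (simp add: distrib_right mult.assoc)
  qed
  \<comment> \<open>Additivity requires measurable integrands, so the integral is split for
    \<open>v\<close> before \<open>v\<close> is replaced by \<open>w\<close>.\<close>
  also have "\<dots> = c * (\<integral>\<^sup>+x. ennreal (a x) * v x \<partial>M) + d * (\<integral>\<^sup>+x. v x \<partial>M)"
    by (simp add: nn_integral_add nn_integral_cmult)
  also have "\<dots> \<le> c * (\<integral>\<^sup>+x. ennreal (a x) * w x \<partial>M) + d * (\<integral>\<^sup>+x. w x \<partial>M)"
    by (intro add_mono mult_left_mono nn_integral_mono v_le) auto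
  finally show "integral\<^sup>S M u \<le> \<dots>" .
qed

text \<open>Hoelder's inequality with exponents \<open>1 / \<theta>\<close> and
  \<open>1 / (1 - \<theta>)\<close>, in a form that allows a non-measurable
  \<open>w\<close>.\<close>

lemma nn_integral_powr_interpolation:
  fixes a :: "'a \<Rightarrow> real" and w :: "'a \<Rightarrow> ennreal" and A B \<theta> :: real
  assumes [measurable]: "a \<in> borel_measurable M"
    and pos: "\<And>x. 0 < a x"
    and \<theta>: "0 < \<theta>" "\<theta> < 1"
    and A: "(\<integral>\<^sup>+x. ennreal (a x) * w x \<partial>M) = ennreal A" "0 \<le> A"
    and B: "(\<integral>\<^sup>+x. w x \<partial>M) = ennreal B" "0 \<le> B"
  shows "(\<integral>\<^sup>+x. ennreal (a x powr \<theta>) * w x \<partial>M) \<le> ennreal (A powr \<theta> * B powr (1 - \<theta>))"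
    (is "?I \<le> _")
proof -
  \<comment> \<open>The optimal \<open>\<lambda> = B / A\<close> degenerates when \<open>A\<close> or \<open>B\<close> vanishes, hence the shift by \<open>e\<close>.\<close>
  have bound: "?I \<le> ennreal ((A + e) powr \<theta> * (B + e) powr (1 - \<theta>))" if e: "0 < e" for e :: real
  proof -
    define c where "c = (B + e) / (A + e)"
    have AB: "0 < A + e" "0 < B + e" and c: "0 < c"
      using A B e by (auto simp: c_def)
    have "?I \<le> ennreal (\<theta> * c powr (1 - \<theta>)) * (\<integral>\<^sup>+x. ennreal (a x) * w x \<partial>M)
        + ennreal ((1 - \<theta>) * c powr (- \<theta>)) * (\<integral>\<^sup>+x. w x \<partial>M)"
    proof (rule nn_integral_weight_le_linear)
      fix x
      show "0 < a x powr \<theta>"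
        using pos[of x] by simp
      show "ennreal (a x powr \<theta>) \<le>
          ennreal (\<theta> * c powr (1 - \<theta>)) * ennreal (a x) + ennreal ((1 - \<theta>) * c powr (- \<theta>))"
        using Young_powr_scaled[OF pos[of x] c, of \<theta>] \<theta> pos[of x]
        by (simp add: ennreal_leI flip: ennreal_mult ennreal_plus)
    qed measurable
    also have "\<dots> = ennreal (\<theta> * c powr (1 - \<theta>) * A + (1 - \<theta>) * c powr (- \<theta>) * B)"
      using A B \<theta> by (simp flip: ennreal_mult ennreal_plus)
    \<comment> \<open>Once \<open>A\<close> and \<open>B\<close> are enlarged by \<open>e\<close>,
      the choice of \<open>c\<close> turns both summands into multiples of the same product, with
      coefficients \<open>\<theta>\<close> and \<open>1 - \<theta>\<close> that add up to 1.\<close>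
    also have "\<dots> \<le> ennreal (\<theta> * (c powr (1 - \<theta>) * (A + e)) + (1 - \<theta>) * (c powr (- \<theta>) * (B + e)))"
      using e \<theta> unfolding mult.assoc
      by (intro ennreal_leI add_mono mult_left_mono) auto
    also have "c powr (1 - \<theta>) * (A + e) = (A + e) powr \<theta> * (B + e) powr (1 - \<theta>)"
      using AB by (simp add: c_def powr_divide powr_diff)
    also have "c powr (- \<theta>) * (B + e) = (A + e) powr \<theta> * (B + e) powr (1 - \<theta>)"
      using AB by (simp add: c_def powr_divide powr_diff powr_minus field_simps)
    finally show ?thesis
      by (simp add: algebra_simps)
  qed
  \<comment> \<open>Both exponents are positive, so the powers are continuous from the right even at
    base 0.\<close>
  have "((\<lambda>e. ennreal ((A + e) powr \<theta> * (B + e) powr (1 - \<theta>)))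
      \<longlongrightarrow> ennreal ((A + 0) powr \<theta> * (B + 0) powr (1 - \<theta>))) (at_right 0)"
    using \<theta> A B
    by (intro tendsto_ennrealI tendsto_mult tendsto_powr' tendsto_add tendsto_const tendsto_ident_at)
      (auto intro!: eventually_at_rightI[of 0 1])
  then have "((\<lambda>e. ennreal ((A + e) powr \<theta> * (B + e) powr (1 - \<theta>)))
      \<longlongrightarrow> ennreal (A powr \<theta> * B powr (1 - \<theta>))) (at_right 0)"
    by simp
  then show ?thesis
    by (rule tendsto_lowerbound) (auto intro!: eventually_at_rightI[of 0 1] bound)
qed

lemma f_inf_borel_measurable [measurable]: "f_inf \<in> borel_measurable lebesgue"
proof -
  have "f_inf \<in> borel_measurable borel"
    unfolding f_inf_def[abs_def] by measurable
  then have "f_inf \<in> borel_measurable lborel"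
    by simp
  then show ?thesis
    by (rule measurable_completion)
qed

theorem theorem4p1:
  fixes P :: "real ^ 'n ^ 'n" and f g :: "real ^ 'n \<Rightarrow> real" and p :: real
  assumes "positive_definite P"
    and "f \<in> borel_measurable lebesgue"
    and "AE x in lebesgue. 0 < f x"
    and "H1_loc g"
    and "fisher_information 2 P f g < \<infinity>"
    and "fisher_information 1 P f g < \<infinity>"
    and "1 < p" and "p < 2"
  shows "fisher_information p P f g \<le>
    ennreal (1 / ((p - 1) powr (p - 1) * (2 - p) powr (2 - p)) *
      enn2real (fisher_information 1 P f g) powr (2 - p) *
      enn2real (fisher_information_2 P g) powr (p - 1))"
proof -
  have [measurable]: "f \<in> borel_measurable lebesgue"
    by (fact assms)
  define w where "w x = ennreal ((weak_gradient (\<lambda>y. g y / f_inf y) x \<bullet>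
      (P *v weak_gradient (\<lambda>y. g y / f_inf y) x)) * f_inf x)" for x
  \<comment> \<open>The value 1 on the null set where \<open>f\<close> is not positive makes
    \<open>a\<close> positive everywhere, as the interpolation lemma demands.\<close>
  define a where "a x = (if 0 < f x then f_inf x / f x else 1)" for x
  have a_pos: "0 < a x" for x
    by (simp add: a_def f_inf_pos)
  have [measurable]: "a \<in> borel_measurable lebesgue"
    unfolding a_def by measurable
  have info_eq: "fisher_information q P f g = (\<integral>\<^sup>+x. ennreal (a x powr (2 - q)) * w x \<partial>lebesgue)" for q
    unfolding fisher_information_def
  proof (rule nn_integral_cong_AE, use assms(3) in eventually_elim)
    case (elim x)
    have "(f x / f_inf x) powr (q - 2) = a x powr (2 - q)"
      using elim f_inf_pos[of x] by (simp add: a_def powr_divide powr_diff field_simps)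
    then show ?case
      by (simp add: w_def mult.assoc ennreal_mult')
  qed
  let ?A = "enn2real (fisher_information 1 P f g)" and ?B = "enn2real (fisher_information_2 P g)"
  have "(\<integral>\<^sup>+x. ennreal (a x) * w x \<partial>lebesgue) = fisher_information 1 P f g"
    using a_pos by (simp add: info_eq less_imp_le)
  then have A: "(\<integral>\<^sup>+x. ennreal (a x) * w x \<partial>lebesgue) = ennreal ?A"
    using assms(6) by simp
  have B: "(\<integral>\<^sup>+x. w x \<partial>lebesgue) = ennreal ?B"
    using assms(5) fisher_information_2_eq[OF assms(3), of P g]
    by (simp add: fisher_information_2_def w_def)
  have "fisher_information p P f g \<le> ennreal (?A powr (2 - p) * ?B powr (p - 1))"
    using nn_integral_powr_interpolation[OF _ a_pos _ _ A _ B, of "2 - p"] assms(7,8)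
    by (simp add: info_eq)
  also have "\<dots> \<le> ennreal (1 / ((p - 1) powr (p - 1) * (2 - p) powr (2 - p)) *
      (?A powr (2 - p) * ?B powr (p - 1)))"
  proof (rule ennreal_leI)
    \<comment> \<open>Both bases lie between 0 and 1 and both exponents are positive.\<close>
    have "(p - 1) powr (p - 1) * (2 - p) powr (2 - p) \<le> 1 * 1"
      using assms(7,8) by (intro mult_mono powr_le1) auto
    then have "1 \<le> 1 / ((p - 1) powr (p - 1) * (2 - p) powr (2 - p))"
      using assms(7,8) by simp
    then show "?A powr (2 - p) * ?B powr (p - 1) \<le>
        1 / ((p - 1) powr (p - 1) * (2 - p) powr (2 - p)) * (?A powr (2 - p) * ?B powr (p - 1))"
      by (metis mult_right_mono mult_1 mult_nonneg_nonneg powr_ge_zero)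
  qed
  finally show ?thesis
    by (simp only: mult.assoc)
qed

end
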